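(* Let $p\in\mathbb R^I$ be a probability vector with positive entries. If $\vartheta_p<0$, then under every stationary Markov control $v$ the limiting diffusion $X$ is transient. If $\vartheta_p=0$, then under no stationary Markov control does $X$ have an invariant probability measure (in particular it is not positive recurrent).
   Context: Network and parameters: $\mathcal I=\{1,\dots,I\}$, $\mathcal J=\{1,\dots,J\}$, edges $\mathcal E\subset\mathcal I\times\mathcal J$ with the bipartite graph $\mathcal G=(\mathcal I\cup\mathcal J,\mathcal E)$ a tree; $i\sim j$ iff $(i,j)\in\mathcal E$, $\mathcal J(i)=\{j:i\sim j\}$, $\mathcal I(j)=\{i:i\sim j\}$; $\mathbb R^{\mathcal G}$ denotes arrays in $\mathbb R^{I\times J}$ vanishing off $\mathcal E$, $\mathbb R^{\mathcal G}_+$ those with nonnegative entries. Limiting parameters $\lambda_i>0$, $\nu_j>0$, $\mu_{ij}>0$, $\hat\lambda_i,\hat\mu_{ij},\hat\nu_j\in\mathbb R$. Complete resource pooling: the LP "minimize $\max_j\sum_i\xi_{ij}$ over $\xi\in\mathbb R^{\mathcal G}_+$ subject to $\sum_j\mu_{ij}\nu_j\xi_{ij}=\lambda_i$ $\forall i$" has a unique solution $\xi^*$, with $\sum_i\xi^*_{ij}=1$ $\forall j$ and $\xi^*_{ij}>0$ for $i\sim j$; $z^*_{ij}:=\xi^*_{ij}\nu_j$, $\theta_j:=\hat\nu_j+\sum_{i\in\mathcal I(j)}(\hat\mu_{ij}/\mu_{ij})z^*_{ij}$, $h_i:=\hat\lambda_i-\sum_{j\in\mathcal J(i)}(\mu_{ij}\xi^*_{ij}\hat\nu_j+\hat\mu_{ij}z^*_{ij})$.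 SWSS: for a probability vector $p$ with positive entries, $\vartheta_p$ is the (unique) optimal value of: maximize $\vartheta$ over $(\vartheta,\kappa)\in\mathbb R\times\mathbb R^{\mathcal G}$ subject to $\hat\lambda_i\le\sum_{j\in\mathcal J(i)}\mu_{ij}\kappa_{ij}-\vartheta p_i$ $\forall i$ and $\sum_{i\in\mathcal I(j)}\kappa_{ij}=\theta_j$ $\forall j$. Limiting diffusion: let $\mathcal D=\{(\alpha,\beta)\in\mathbb R^I\times\mathbb R^J:\sum_i\alpha_i=\sum_j\beta_j\}$ and $\Psi:\mathcal D\to\mathbb R^{\mathcal G}$ the unique linear map with $\sum_j\Psi_{ij}(\alpha,\beta)=\alpha_i$, $\sum_i\Psi_{ij}(\alpha,\beta)=\beta_j$. Let $e$ be the all-ones vector, $a^\pm$ positive/negative parts, $\mathbb U=\Delta_I\times\Delta_J$ with $\Delta_I=\{u\in\mathbb R^I_+:\langle e,u\rangle=1\}$, $\Delta_J$ likewise. The drift is $b_i(x,u):=h_i-\sum_{j\in\mathcal J(i)}\mu_{ij}\Psi_{ij}\big(x-\langle e,x\rangle^+u^c,-\langle e,x\rangle^-u^s\big)$ for $x\in\mathbb R^I$, $u=(u^c,u^s)\in\mathbb U$. A stationary Markov control is a measurable $v:\mathbb R^I\to\mathbb U$, and the controlled diffusion is $dX_t=b(X_t,v(X_t))\,dt+\Sigma\,dW_t$ with $W$ a standard $I$-dimensional Brownian motion and $\Sigma=\mathrm{diag}(\sqrt{2\lambda_1},\dots,\sqrt{2\lambda_I})$. *)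

theory Defs
  imports "HOL-Probability.Probability"
begin

section \<open>Network\<close>

text \<open>Arrays in R^G: functions 'i => 'j => real vanishing off the edge set E.\<close>
definition in_G :: "('i \<times> 'j) set \<Rightarrow> ('i \<Rightarrow> 'j \<Rightarrow> real) \<Rightarrow> bool" where
  "in_G E a \<longleftrightarrow> (\<forall>i j. (i, j) \<notin> E \<longrightarrow> a i j = 0)"

text \<open>Adjacency of the (undirected) bipartite graph on vertex set I + J.\<close>
definition bip_adj :: "('i \<times> 'j) set \<Rightarrow> ('i + 'j) rel" where
  "bip_adj E = {(Inl i, Inr j) | i j. (i, j) \<in> E} \<union> {(Inr j, Inl i) | i j. (i, j) \<in> E}"

definition graph_connected :: "('i \<times> 'j) set \<Rightarrow> bool" where
  "graph_connected E \<longleftrightarrow> (\<forall>u v. (u, v) \<in> (bip_adj E)\<^sup>*)"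

text \<open>A tree = a minimally connected graph (connected, and removing any edge disconnects it).\<close>
definition is_tree :: "('i \<times> 'j) set \<Rightarrow> bool" where
  "is_tree E \<longleftrightarrow> graph_connected E \<and> (\<forall>e\<in>E. \<not> graph_connected (E - {e}))"

section \<open>Complete resource pooling LP\<close>

definition crp_feasible ::
  "('i::finite \<times> 'j::finite) set \<Rightarrow> ('i \<Rightarrow> 'j \<Rightarrow> real) \<Rightarrow> ('j \<Rightarrow> real) \<Rightarrow> ('i \<Rightarrow> real)
    \<Rightarrow> ('i \<Rightarrow> 'j \<Rightarrow> real) \<Rightarrow> bool" where
  "crp_feasible E mu nu lam \<xi> \<longleftrightarrow> in_G E \<xi> \<and> (\<forall>i j. 0 \<le> \<xi> i j) \<and>
     (\<forall>i. (\<Sum>j\<in>UNIV. mu i j * nu j * \<xi> i j) = lam i)"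

definition crp_obj :: "('i::finite \<Rightarrow> 'j::finite \<Rightarrow> real) \<Rightarrow> real" where
  "crp_obj \<xi> = Max (range (\<lambda>j. \<Sum>i\<in>UNIV. \<xi> i j))"

text \<open>xis is the unique solution of the LP.\<close>
definition crp_unique_solution ::
  "('i::finite \<times> 'j::finite) set \<Rightarrow> ('i \<Rightarrow> 'j \<Rightarrow> real) \<Rightarrow> ('j \<Rightarrow> real) \<Rightarrow> ('i \<Rightarrow> real)
    \<Rightarrow> ('i \<Rightarrow> 'j \<Rightarrow> real) \<Rightarrow> bool" where
  "crp_unique_solution E mu nu lam xis \<longleftrightarrow> crp_feasible E mu nu lam xis \<and>
     (\<forall>\<xi>. crp_feasible E mu nu lam \<xi> \<and> \<xi> \<noteq> xis \<longrightarrow> crp_obj xis < crp_obj \<xi>)"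

definition zstar :: "('i \<Rightarrow> 'j \<Rightarrow> real) \<Rightarrow> ('j \<Rightarrow> real) \<Rightarrow> 'i \<Rightarrow> 'j \<Rightarrow> real" where
  "zstar xis nu i j = xis i j * nu j"

definition theta_par ::
  "('i \<times> 'j) set \<Rightarrow> ('i \<Rightarrow> 'j \<Rightarrow> real) \<Rightarrow> ('j \<Rightarrow> real) \<Rightarrow> ('i \<Rightarrow> 'j \<Rightarrow> real) \<Rightarrow> ('j \<Rightarrow> real)
    \<Rightarrow> ('i \<Rightarrow> 'j \<Rightarrow> real) \<Rightarrow> 'j \<Rightarrow> real" where
  "theta_par E mu nu muh nuh xis j =
     nuh j + (\<Sum>i\<in>{i. (i, j) \<in> E}. (muh i j / mu i j) * zstar xis nu i j)"

definition h_par ::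
  "('i \<times> 'j) set \<Rightarrow> ('i \<Rightarrow> 'j \<Rightarrow> real) \<Rightarrow> ('j \<Rightarrow> real) \<Rightarrow> ('i \<Rightarrow> real) \<Rightarrow> ('i \<Rightarrow> 'j \<Rightarrow> real)
    \<Rightarrow> ('j \<Rightarrow> real) \<Rightarrow> ('i \<Rightarrow> 'j \<Rightarrow> real) \<Rightarrow> 'i \<Rightarrow> real" where
  "h_par E mu nu lamh muh nuh xis i =
     lamh i - (\<Sum>j\<in>{j. (i, j) \<in> E}. mu i j * xis i j * nuh j + muh i j * zstar xis nu i j)"

section \<open>SWSS LP\<close>

definition swss_feasible ::
  "('i \<times> 'j) set \<Rightarrow> ('i \<Rightarrow> 'j \<Rightarrow> real) \<Rightarrow> ('j \<Rightarrow> real) \<Rightarrow> ('i \<Rightarrow> real) \<Rightarrow> ('i \<Rightarrow> real)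
    \<Rightarrow> real \<Rightarrow> ('i \<Rightarrow> 'j \<Rightarrow> real) \<Rightarrow> bool" where
  "swss_feasible E mu theta lamh p t \<kappa> \<longleftrightarrow> in_G E \<kappa> \<and>
     (\<forall>i. lamh i \<le> (\<Sum>j\<in>{j. (i, j) \<in> E}. mu i j * \<kappa> i j) - t * p i) \<and>
     (\<forall>j. (\<Sum>i\<in>{i. (i, j) \<in> E}. \<kappa> i j) = theta j)"

text \<open>t is the optimal value (vartheta_p) of the SWSS LP.\<close>
definition is_swss_value ::
  "('i \<times> 'j) set \<Rightarrow> ('i \<Rightarrow> 'j \<Rightarrow> real) \<Rightarrow> ('j \<Rightarrow> real) \<Rightarrow> ('i \<Rightarrow> real) \<Rightarrow> ('i \<Rightarrow> real)
    \<Rightarrow> real \<Rightarrow> bool" where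
  "is_swss_value E mu theta lamh p t \<longleftrightarrow>
     (\<exists>\<kappa>. swss_feasible E mu theta lamh p t \<kappa>) \<and>
     (\<forall>t' \<kappa>'. swss_feasible E mu theta lamh p t' \<kappa>' \<longrightarrow> t' \<le> t)"

section \<open>Limiting diffusion\<close>

text \<open>Psi(alpha, beta): the unique array in R^G with row sums alpha and column sums beta.\<close>
definition Psi :: "('i::finite \<times> 'j::finite) set \<Rightarrow> ('i \<Rightarrow> real) \<Rightarrow> ('j \<Rightarrow> real) \<Rightarrow> 'i \<Rightarrow> 'j \<Rightarrow> real" where
  "Psi E \<alpha> \<beta> = (THE \<psi>. in_G E \<psi> \<and> (\<forall>i. (\<Sum>j\<in>UNIV. \<psi> i j) = \<alpha> i) \<and> (\<forall>j. (\<Sum>i\<in>UNIV. \<psi> i j) = \<beta> j))"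

definition posp :: "real \<Rightarrow> real" where "posp a = max a 0"
definition negp :: "real \<Rightarrow> real" where "negp a = max (- a) 0"

definition vsum :: "real^'n::finite \<Rightarrow> real" where
  "vsum x = (\<Sum>i\<in>UNIV. x $ i)"

text \<open>The control set U = Delta_I x Delta_J.\<close>
definition ctrl_set :: "((real^'i::finite) \<times> (real^'j::finite)) set" where
  "ctrl_set = {(uc, us). (\<forall>i. 0 \<le> uc $ i) \<and> vsum uc = 1 \<and> (\<forall>j. 0 \<le> us $ j) \<and> vsum us = 1}"

definition drift ::
  "('i::finite \<times> 'j::finite) set \<Rightarrow> ('i \<Rightarrow> 'j \<Rightarrow> real) \<Rightarrow> ('i \<Rightarrow> real)
    \<Rightarrow> real^'i \<Rightarrow> ((real^'i) \<times> (real^'j)) \<Rightarrow> real^'i" where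
  "drift E mu h x u = (\<chi> i. h i - (\<Sum>j\<in>{j. (i, j) \<in> E}.
      mu i j * Psi E (\<lambda>i'. x $ i' - posp (vsum x) * fst u $ i') (\<lambda>j'. - negp (vsum x) * snd u $ j') i j))"

definition stat_markov_control :: "(real^'i::finite \<Rightarrow> (real^'i) \<times> (real^'j::finite)) \<Rightarrow> bool" where
  "stat_markov_control v \<longleftrightarrow> v \<in> borel_measurable borel \<and> (\<forall>x. v x \<in> ctrl_set)"

section \<open>Brownian motion and weak solutions\<close>

text \<open>Gaussian law N(0, h Id) on R^I.\<close>
definition gauss_vec :: "real \<Rightarrow> (real^'i::finite) measure" where
  "gauss_vec h = density lborel
     (\<lambda>x. ennreal ((2 * pi * h) powr (- real CARD('i) / 2) * exp (- (norm x)\<^sup>2 / (2 * h))))"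

definition is_filtration :: "'a measure \<Rightarrow> (real \<Rightarrow> 'a measure) \<Rightarrow> bool" where
  "is_filtration M F \<longleftrightarrow> (\<forall>t. subalgebra M (F t)) \<and> (\<forall>s t. s \<le> t \<longrightarrow> sets (F s) \<subseteq> sets (F t))"

text \<open>Standard I-dimensional (F_t)-Brownian motion.\<close>
definition is_BM_wrt :: "'a measure \<Rightarrow> (real \<Rightarrow> 'a measure) \<Rightarrow> (real \<Rightarrow> 'a \<Rightarrow> real^'i::finite) \<Rightarrow> bool" where
  "is_BM_wrt M F W \<longleftrightarrow>
     (\<forall>t\<ge>0. W t \<in> borel_measurable (F t)) \<and>
     (AE \<omega> in M. W 0 \<omega> = 0 \<and> continuous_on {0..} (\<lambda>t. W t \<omega>)) \<and>
     (\<forall>s t A B. 0 \<le> s \<longrightarrow> s < t \<longrightarrow> A \<in> sets (F s) \<longrightarrow> B \<in> sets borel \<longrightarrow>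
        measure M (A \<inter> {\<omega>\<in>space M. W t \<omega> - W s \<omega> \<in> B}) = measure M A * measure (gauss_vec (t - s)) B)"

text \<open>Weak solution of dX = b(X, v(X)) dt + Sigma dW, Sigma = diag(sqrt(2 lam_i)).\<close>
definition weak_solution ::
  "'a measure \<Rightarrow> (real \<Rightarrow> 'a measure) \<Rightarrow> (real \<Rightarrow> 'a \<Rightarrow> real^'i::finite) \<Rightarrow> (real \<Rightarrow> 'a \<Rightarrow> real^'i)
    \<Rightarrow> (real^'i \<Rightarrow> 'u \<Rightarrow> real^'i) \<Rightarrow> (real^'i \<Rightarrow> 'u) \<Rightarrow> ('i \<Rightarrow> real) \<Rightarrow> bool" where
  "weak_solution M F W X b v lam \<longleftrightarrow>
     prob_space M \<and> is_filtration M F \<and> is_BM_wrt M F W \<and>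
     (\<forall>t\<ge>0. X t \<in> borel_measurable (F t)) \<and>
     (AE \<omega> in M. continuous_on {0..} (\<lambda>t. X t \<omega>) \<and>
        (\<forall>t\<ge>0. (\<lambda>s. b (X s \<omega>) (v (X s \<omega>))) absolutely_integrable_on {0..t} \<and>
           X t \<omega> = X 0 \<omega> + integral {0..t} (\<lambda>s. b (X s \<omega>) (v (X s \<omega>)))
                   + (\<chi> i. sqrt (2 * lam i) * W t \<omega> $ i)))"

text \<open>Transience: from every deterministic initial point, |X_t| -> infinity a.s.
  (quantifying over weak solutions on probability spaces of type 'a).\<close>
definition transient :: "'a itself \<Rightarrow> (real^'i::finite \<Rightarrow> 'u \<Rightarrow> real^'i) \<Rightarrow> (real^'i \<Rightarrow> 'u)
    \<Rightarrow> ('i \<Rightarrow> real) \<Rightarrow> bool" where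
  "transient _ b v lam \<longleftrightarrow>
     (\<forall>x (M::'a measure) F W X. weak_solution M F W X b v lam \<longrightarrow> (AE \<omega> in M. X 0 \<omega> = x) \<longrightarrow>
        (AE \<omega> in M. filterlim (\<lambda>t. norm (X t \<omega>)) at_top at_top))"

text \<open>Existence of an invariant probability measure: some weak solution whose one-dimensional
  marginal law is a probability measure mu for all times t >= 0.\<close>
definition has_invariant_prob :: "'a itself \<Rightarrow> (real^'i::finite \<Rightarrow> 'u \<Rightarrow> real^'i) \<Rightarrow> (real^'i \<Rightarrow> 'u)
    \<Rightarrow> ('i \<Rightarrow> real) \<Rightarrow> bool" where
  "has_invariant_prob _ b v lam \<longleftrightarrow>
     (\<exists>(M::'a measure) F W X (\<mu>::(real^'i) measure). weak_solution M F W X b v lam \<and>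
        prob_space \<mu> \<and> sets \<mu> = sets borel \<and> (\<forall>t\<ge>0. distr M borel (X t) = \<mu>))"

end

theory Submission
  imports Defs "HOL-Real_Asymp.Real_Asymp"
begin

text \<open>
  On a tree the edge rates have a potential: there are positive weights \<open>y\<close>, \<open>z\<close> with
  \<open>y i * mu i j = z j\<close> on all edges. Pairing the drift with \<open>y\<close> therefore only sees the column
  sums of \<open>Psi\<close>, so that \<open>y \<bullet> b(x, u)\<close> is the constant \<open>y \<bullet> h\<close> plus the nonnegative idleness
  term \<open>negp (vsum x) * (z \<bullet> u\<^sup>s)\<close>. The constant is \<open>- t * (y \<bullet> p)\<close> for a number \<open>t\<close> that is
  feasible for the SWSS program, hence \<open>t \<le> vt\<close>. Thus \<open>y \<bullet> X t\<close> dominates a Brownian motion with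
  positive drift if \<open>vt < 0\<close>, and a driftless one, started at \<open>y \<bullet> X 0\<close>, if \<open>vt = 0\<close>; the former
  tends to infinity almost surely and the latter is not tight.
\<close>

section \<open>Arrays and potentials on a tree\<close>

text \<open>The component of the left endpoint of \<open>e\<close> after \<open>e\<close> has been removed.\<close>

definition side :: "('i \<times> 'j) set \<Rightarrow> 'i \<times> 'j \<Rightarrow> ('i + 'j) set" where
  "side E e = (bip_adj (E - {e}))\<^sup>* `` {Inl (fst e)}"

lemma sym_bip_adj: "sym (bip_adj E)"
  by (auto simp: bip_adj_def sym_def)

text \<open>If the endpoints of \<open>e\<close> were still joined after its removal, the joining
  path could replace \<open>e\<close> everywhere and \<open>E - {e}\<close> would be connected,
  against minimality. Every other edge survives the removal, so its endpoints stay in one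
  component.\<close>

lemma side_cut:
  assumes "is_tree E" "e \<in> E"
  shows "Inl (fst e) \<in> side E e" "Inr (snd e) \<notin> side E e"
    and "(i, j) \<in> E \<Longrightarrow> (i, j) \<noteq> e \<Longrightarrow> Inl i \<in> side E e \<longleftrightarrow> Inr j \<in> side E e"
proof -
  let ?R = "bip_adj (E - {e})"
  show "Inl (fst e) \<in> side E e"
    by (simp add: side_def)
  show "Inr (snd e) \<notin> side E e"
  proof
    assume "Inr (snd e) \<in> side E e"
    then have *: "(Inl (fst e), Inr (snd e)) \<in> ?R\<^sup>*"
      by (simp add: side_def)
    then have "(Inr (snd e), Inl (fst e)) \<in> ?R\<^sup>*"
      using sym_rtrancl[OF sym_bip_adj] by (metis symE)
    note bwd = this
    have "bip_adj E \<subseteq> ?R \<union> {(Inl (fst e), Inr (snd e)), (Inr (snd e), Inl (fst e))}"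
      by (auto simp: bip_adj_def)
    with * bwd have "bip_adj E \<subseteq> ?R\<^sup>*"
      by blast
    then have "(bip_adj E)\<^sup>* \<subseteq> ?R\<^sup>*"
      by (metis rtrancl_mono rtrancl_idemp)
    then have "graph_connected (E - {e})"
      using assms(1) by (auto simp: is_tree_def graph_connected_def)
    then show False
      using assms by (auto simp: is_tree_def)
  qed
  assume "(i, j) \<in> E" "(i, j) \<noteq> e"
  then have "(Inl i, Inr j) \<in> ?R" "(Inr j, Inl i) \<in> ?R"
    by (auto simp: bip_adj_def)
  then show "Inl i \<in> side E e \<longleftrightarrow> Inr j \<in> side E e"
    by (auto simp: side_def intro: rtrancl_into_rtrancl)
qed

text \<open>Without cycles there is no compatibility condition on the differences along edges. This
  serves twice: with an array itself as \<open>c\<close> for uniqueness, and with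
  \<open>ln (mu i j)\<close> for the weights.\<close>

lemma tree_potential:
  fixes E :: "('i::finite \<times> 'j::finite) set" and c :: "'i \<Rightarrow> 'j \<Rightarrow> real"
  assumes "is_tree E"
  obtains f g where "\<And>i j. (i, j) \<in> E \<Longrightarrow> g j - f i = c i j"
proof
  \<comment> \<open>Crossing an edge changes sides only for the cut of that edge.\<close>
  define \<phi> where "\<phi> w = (\<Sum>e\<in>E. of_bool (w \<notin> side E e) * c (fst e) (snd e))" for w
  fix i j assume ij: "(i, j) \<in> E"
  have "\<phi> (Inr j) - \<phi> (Inl i) =
      (\<Sum>e\<in>E. (of_bool (Inr j \<notin> side E e) - of_bool (Inl i \<notin> side E e)) * c (fst e) (snd e))"
    by (simp add: \<phi>_def sum_subtractf left_diff_distrib)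
  also have "\<dots> = (\<Sum>e\<in>E. if e = (i, j) then c i j else 0)"
  proof (intro sum.cong refl)
    fix e assume e: "e \<in> E"
    show "(of_bool (Inr j \<notin> side E e) - of_bool (Inl i \<notin> side E e)) * c (fst e) (snd e) =
        (if e = (i, j) then c i j else 0)"
      using side_cut(1,2)[OF assms e] side_cut(3)[OF assms e ij] by (cases "e = (i, j)") auto
  qed
  also have "\<dots> = c i j"
    using ij by (simp add: sum.delta)
  finally show "\<phi> (Inr j) - \<phi> (Inl i) = c i j" .
qed

section \<open>Existence and uniqueness of arrays with prescribed marginals\<close>

text \<open>Columns carry a minus sign, so that an edge contributes a difference of two point masses
  and a path telescopes.\<close>

definition balanced :: "('i::finite \<times> 'j::finite) set \<Rightarrow> ('i + 'j \<Rightarrow> real) \<Rightarrow> bool" where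
  "balanced E g \<longleftrightarrow> (\<exists>\<psi>. in_G E \<psi> \<and> (\<forall>i. (\<Sum>j\<in>UNIV. \<psi> i j) = g (Inl i)) \<and>
     (\<forall>j. (\<Sum>i\<in>UNIV. \<psi> i j) = - g (Inr j)))"

lemma balanced_zero: "balanced E (\<lambda>_. 0)"
  unfolding balanced_def by (rule exI[of _ "\<lambda>_ _. 0"]) (auto simp: in_G_def)

lemma balanced_add:
  assumes "balanced E g" "balanced E g'"
  shows "balanced E (\<lambda>w. g w + g' w)"
proof -
  obtain \<psi> \<psi>' where "in_G E \<psi>" "\<forall>i. (\<Sum>j\<in>UNIV. \<psi> i j) = g (Inl i)" "\<forall>j. (\<Sum>i\<in>UNIV. \<psi> i j) = - g (Inr j)"
    "in_G E \<psi>'" "\<forall>i. (\<Sum>j\<in>UNIV. \<psi>' i j) = g' (Inl i)" "\<forall>j. (\<Sum>i\<in>UNIV. \<psi>' i j) = - g' (Inr j)"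
    using assms unfolding balanced_def by metis
  then show ?thesis
    unfolding balanced_def
    by (intro exI[of _ "\<lambda>i j. \<psi> i j + \<psi>' i j"]) (auto simp: in_G_def sum.distrib)
qed

lemma balanced_scale:
  assumes "balanced E g"
  shows "balanced E (\<lambda>w. a * g w)"
proof -
  obtain \<psi> where "in_G E \<psi>" "\<forall>i. (\<Sum>j\<in>UNIV. \<psi> i j) = g (Inl i)" "\<forall>j. (\<Sum>i\<in>UNIV. \<psi> i j) = - g (Inr j)"
    using assms unfolding balanced_def by metis
  then show ?thesis
    unfolding balanced_def
    by (intro exI[of _ "\<lambda>i j. a * \<psi> i j"]) (auto simp: in_G_def simp flip: sum_distrib_left)
qed

lemma balanced_sum:
  assumes "finite A" "\<And>u. u \<in> A \<Longrightarrow> balanced E (g u)"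
  shows "balanced E (\<lambda>w. \<Sum>u\<in>A. g u w)"
  using assms by (induction A rule: finite_induct) (auto intro: balanced_zero balanced_add)

lemma balanced_edge:
  assumes "(i, j) \<in> E"
  shows "balanced E (\<lambda>w. of_bool (w = Inl i) - of_bool (w = Inr j))"
proof -
  have "(\<Sum>j'\<in>UNIV. of_bool (i' = i \<and> j' = j)) = (of_bool (i' = i) :: real)" for i'
    by (cases "i' = i") auto
  moreover have "(\<Sum>i'\<in>UNIV. of_bool (i' = i \<and> j' = j)) = (of_bool (j' = j) :: real)" for j'
    by (cases "j' = j") auto
  ultimately show ?thesis
    unfolding balanced_def using assms
    by (intro exI[of _ "\<lambda>i' j'. of_bool (i' = i \<and> j' = j)"]) (auto simp: in_G_def)
qed

lemma balanced_path:
  assumes "(u, v) \<in> (bip_adj E)\<^sup>*"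
  shows "balanced E (\<lambda>w. of_bool (w = u) - of_bool (w = v))"
  using assms
proof (induction rule: rtrancl_induct)
  case base
  show ?case by (simp add: balanced_zero)
next
  case (step v v')
  \<comment> \<open>A step from a column to a row uses the edge with the factor -1.\<close>
  have "balanced E (\<lambda>w. of_bool (w = v) - of_bool (w = v'))"
    using step(2) unfolding bip_adj_def
    using balanced_edge balanced_scale[OF balanced_edge, of _ _ E "-1"] by fastforce
  from balanced_add[OF step.IH this] show ?case by simp
qed

text \<open>All mass is moved along paths to one root \<open>r\<close>: \<open>g\<close> is a
  combination of differences of point masses at \<open>u\<close> and at \<open>r\<close>, because
  the mass collected at \<open>r\<close> is the total, which is zero.\<close>

lemma connected_balanced:
  fixes E :: "('i::finite \<times> 'j::finite) set"
  assumes "graph_connected E" "(\<Sum>w\<in>UNIV. g w) = 0"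
  shows "balanced E g"
proof -
  fix r :: "'i + 'j"
  have "balanced E (\<lambda>w. \<Sum>u\<in>UNIV. g u * (of_bool (w = u) - of_bool (w = r)))"
    using assms(1) by (intro balanced_sum balanced_scale balanced_path) (auto simp: graph_connected_def)
  also have "(\<lambda>w. \<Sum>u\<in>UNIV. g u * (of_bool (w = u) - of_bool (w = r))) = g"
  proof
    fix w
    have "(\<Sum>u\<in>UNIV. g u * (of_bool (w = u) - of_bool (w = r)))
       = (\<Sum>u\<in>UNIV. g u * of_bool (w = u)) - (\<Sum>u\<in>UNIV. g u) * of_bool (w = r)"
      by (simp only: right_diff_distrib sum_subtractf sum_distrib_right)
    then show "(\<Sum>u\<in>UNIV. g u * (of_bool (w = u) - of_bool (w = r))) = g w"
      using assms(2) by (simp add: of_bool_def if_distrib cong: if_cong)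
  qed
  finally show ?thesis .
qed

lemma tree_array_exists:
  fixes \<alpha> :: "'i::finite \<Rightarrow> real" and \<beta> :: "'j::finite \<Rightarrow> real"
  assumes "is_tree E" "(\<Sum>i\<in>UNIV. \<alpha> i) = (\<Sum>j\<in>UNIV. \<beta> j)"
  obtains \<psi> where "in_G E \<psi>" "\<And>i. (\<Sum>j\<in>UNIV. \<psi> i j) = \<alpha> i" "\<And>j. (\<Sum>i\<in>UNIV. \<psi> i j) = \<beta> j"
proof -
  have "(\<Sum>w\<in>UNIV. case w of Inl i \<Rightarrow> \<alpha> i | Inr j \<Rightarrow> - \<beta> j) = 0"
    using assms(2) by (simp add: sum.Plus sum_negf flip: UNIV_Plus_UNIV)
  then have "balanced E (\<lambda>w. case w of Inl i \<Rightarrow> \<alpha> i | Inr j \<Rightarrow> - \<beta> j)"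
    using assms(1) by (intro connected_balanced) (simp_all add: is_tree_def)
  then show ?thesis
    using that by (auto simp: balanced_def)
qed

text \<open>The potential whose differences along the edges are the array itself turns the
  vanishing of the marginals into the vanishing of the sum of squares.\<close>

lemma tree_array_zero:
  fixes E :: "('i::finite \<times> 'j::finite) set"
  assumes "is_tree E" "in_G E \<psi>" and row: "\<And>i. (\<Sum>j\<in>UNIV. \<psi> i j) = 0" and col: "\<And>j. (\<Sum>i\<in>UNIV. \<psi> i j) = 0"
  shows "\<psi> i j = 0"
proof -
  obtain f g where fg: "\<And>i j. (i, j) \<in> E \<Longrightarrow> g j - f i = \<psi> i j"
    using tree_potential[OF assms(1), where c = \<psi>] by metis
  have "(\<Sum>i\<in>UNIV. \<Sum>j\<in>UNIV. \<psi> i j * \<psi> i j) = (\<Sum>i\<in>UNIV. \<Sum>j\<in>UNIV. g j * \<psi> i j - f i * \<psi> i j)"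
    using assms(2) fg by (intro sum.cong refl) (metis in_G_def left_diff_distrib mult_zero_right)
  also have "\<dots> = (\<Sum>i\<in>UNIV. \<Sum>j\<in>UNIV. g j * \<psi> i j) - (\<Sum>i\<in>UNIV. f i * (\<Sum>j\<in>UNIV. \<psi> i j))"
    by (simp add: sum_subtractf sum_distrib_left)
  also have "(\<Sum>i\<in>UNIV. \<Sum>j\<in>UNIV. g j * \<psi> i j) = (\<Sum>j\<in>UNIV. g j * (\<Sum>i\<in>UNIV. \<psi> i j))"
    by (subst sum.swap) (simp add: sum_distrib_left)
  finally have "(\<Sum>i\<in>UNIV. \<Sum>j\<in>UNIV. \<psi> i j * \<psi> i j) = 0"
    by (simp add: row col)
  then show ?thesis
    by (simp add: sum_nonneg_eq_0_iff sum_nonneg)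
qed

text \<open>The definite description denotes: connectedness gives existence, and the difference of
  two solutions has zero marginals, hence vanishes by \<open>tree_array_zero\<close>.\<close>

lemma Psi_spec:
  fixes E :: "('i::finite \<times> 'j::finite) set"
  assumes "is_tree E" "(\<Sum>i\<in>UNIV. \<alpha> i) = (\<Sum>j\<in>UNIV. \<beta> j)"
  shows "in_G E (Psi E \<alpha> \<beta>)" "(\<Sum>j\<in>UNIV. Psi E \<alpha> \<beta> i j) = \<alpha> i" "(\<Sum>i\<in>UNIV. Psi E \<alpha> \<beta> i j) = \<beta> j"
proof -
  let ?P = "\<lambda>\<psi>. in_G E \<psi> \<and> (\<forall>i. (\<Sum>j\<in>UNIV. \<psi> i j) = \<alpha> i) \<and> (\<forall>j. (\<Sum>i\<in>UNIV. \<psi> i j) = \<beta> j)"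
  obtain \<psi> where \<psi>: "?P \<psi>"
    using tree_array_exists[OF assms] by metis
  have "?P (Psi E \<alpha> \<beta>)"
    unfolding Psi_def
  proof (rule theI[of ?P, OF \<psi>])
    fix \<psi>' assume "?P \<psi>'"
    with \<psi> have "\<psi>' i j - \<psi> i j = 0" for i j
      by (intro tree_array_zero[OF assms(1), of "\<lambda>i j. \<psi>' i j - \<psi> i j"]) (auto simp: in_G_def sum_subtractf)
    then show "\<psi>' = \<psi>" by (intro ext) auto
  qed
  then show "in_G E (Psi E \<alpha> \<beta>)" "(\<Sum>j\<in>UNIV. Psi E \<alpha> \<beta> i j) = \<alpha> i" "(\<Sum>i\<in>UNIV. Psi E \<alpha> \<beta> i j) = \<beta> j"
    by auto
qed

text \<open>The multiplicative relation is the exponential of an additive one, so a potential for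
  \<open>ln (mu i j)\<close> yields the weights and their positivity.\<close>

lemma tree_weights:
  fixes E :: "('i::finite \<times> 'j::finite) set" and mu :: "'i \<Rightarrow> 'j \<Rightarrow> real"
  assumes "is_tree E" "\<And>i j. (i, j) \<in> E \<Longrightarrow> 0 < mu i j"
  obtains y z where "\<And>i. 0 < y i" "\<And>j. 0 < z j" "\<And>i j. (i, j) \<in> E \<Longrightarrow> y i * mu i j = z j"
proof -
  obtain f g where fg: "\<And>i j. (i, j) \<in> E \<Longrightarrow> g j - f i = ln (mu i j)"
    using tree_potential[OF assms(1), where c = "\<lambda>i j. ln (mu i j)"] by metis
  have "exp (f i) * mu i j = exp (g j)" if "(i, j) \<in> E" for i j
    using fg[OF that] assms(2)[OF that] by (metis add_diff_cancel_left' diff_add_cancel add.commute exp_add exp_ln)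
  then show ?thesis
    using that[of "\<lambda>i. exp (f i)" "\<lambda>j. exp (g j)"] by simp
qed

section \<open>Pairing the drift with the potential weights\<close>

lemma sum_rows_eq_sum_cols:
  fixes E :: "('i::finite \<times> 'j::finite) set" and G :: "'i \<Rightarrow> 'j \<Rightarrow> real"
  shows "(\<Sum>i\<in>UNIV. \<Sum>j\<in>{j. (i, j) \<in> E}. G i j) = (\<Sum>j\<in>UNIV. \<Sum>i\<in>{i. (i, j) \<in> E}. G i j)"
  using sum.swap_restrict[of "UNIV :: 'i set" "UNIV :: 'j set" G "\<lambda>i j. (i, j) \<in> E"] by simp

lemma sum_edges_eq_sum_UNIV:
  fixes E :: "('i::finite \<times> 'j::finite) set" and G :: "'i \<Rightarrow> 'j \<Rightarrow> real"
  assumes "in_G E G"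
  shows "(\<Sum>i\<in>{i. (i, j) \<in> E}. G i j) = (\<Sum>i\<in>UNIV. G i j)"
    and "(\<Sum>j\<in>{j. (i, j) \<in> E}. G i j) = (\<Sum>j\<in>UNIV. G i j)"
  using assms by (intro sum.mono_neutral_left; auto simp: in_G_def)+

text \<open>As \<open>y i * mu i j\<close> depends on the column alone, exchanging the sums leaves
  only the column sums of \<open>Psi\<close>. The control \<open>fst u\<close> enters the row sums
  only and drops out.\<close>

lemma weighted_drift:
  fixes E :: "('i::finite \<times> 'j::finite) set"
  assumes "is_tree E" and yz: "\<And>i j. (i, j) \<in> E \<Longrightarrow> y i * mu i j = z j" and "u \<in> ctrl_set"
  shows "(\<Sum>i\<in>UNIV. y i * drift E mu h x u $ i) =
    (\<Sum>i\<in>UNIV. y i * h i) + negp (vsum x) * (\<Sum>j\<in>UNIV. z j * snd u $ j)"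
proof -
  let ?\<alpha> = "\<lambda>i'. x $ i' - posp (vsum x) * fst u $ i'"
  let ?\<beta> = "\<lambda>j'. - negp (vsum x) * snd u $ j'"
  let ?\<psi> = "Psi E ?\<alpha> ?\<beta>"
  have "(\<Sum>i\<in>UNIV. ?\<alpha> i) = vsum x - posp (vsum x) * vsum (fst u)"
    by (simp add: vsum_def sum_subtractf sum_distrib_left)
  moreover have "(\<Sum>j\<in>UNIV. ?\<beta> j) = - negp (vsum x) * vsum (snd u)"
    by (simp only: vsum_def sum_distrib_left)
  \<comment> \<open>The totals agree because each control sums to one and a real number is its
    positive part minus its negative part.\<close>
  ultimately have "(\<Sum>i\<in>UNIV. ?\<alpha> i) = (\<Sum>j\<in>UNIV. ?\<beta> j)"
    using \<open>u \<in> ctrl_set\<close> by (auto simp: ctrl_set_def posp_def negp_def)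
  note \<psi> = Psi_spec[OF assms(1) this]
  have "(\<Sum>i\<in>UNIV. y i * (\<Sum>j\<in>{j. (i, j) \<in> E}. mu i j * ?\<psi> i j)) = (\<Sum>i\<in>UNIV. \<Sum>j\<in>{j. (i, j) \<in> E}. z j * ?\<psi> i j)"
    by (auto simp: sum_distrib_left yz mult.assoc[symmetric] intro!: sum.cong)
  also have "\<dots> = (\<Sum>j\<in>UNIV. z j * (\<Sum>i\<in>{i. (i, j) \<in> E}. ?\<psi> i j))"
    by (simp only: sum_rows_eq_sum_cols sum_distrib_left)
  also have "\<dots> = (\<Sum>j\<in>UNIV. z j * ?\<beta> j)"
    by (simp only: sum_edges_eq_sum_UNIV[OF \<psi>(1)] \<psi>(3))
  also have "\<dots> = - (negp (vsum x) * (\<Sum>j\<in>UNIV. z j * snd u $ j))"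
    by (simp add: sum_distrib_left sum_negf mult_ac)
  finally show ?thesis
    by (simp add: drift_def right_diff_distrib sum_subtractf)
qed

text \<open>The same exchange of sums: on edges \<open>y i * muh i j\<close> is
  \<open>z j * (muh i j / mu i j)\<close>, and the unit column sums of \<open>xis\<close> reduce the
  other term to \<open>nuh j\<close>, so that \<open>theta_par\<close> appears.\<close>

lemma weighted_h_par:
  fixes E :: "('i::finite \<times> 'j::finite) set"
  assumes yz: "\<And>i j. (i, j) \<in> E \<Longrightarrow> y i * mu i j = z j" and mu: "\<And>i j. (i, j) \<in> E \<Longrightarrow> 0 < mu i j"
    and "in_G E xis" and one: "\<And>j. (\<Sum>i\<in>UNIV. xis i j) = 1"
  shows "(\<Sum>i\<in>UNIV. y i * h_par E mu nu lamh muh nuh xis i) =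
    (\<Sum>i\<in>UNIV. y i * lamh i) - (\<Sum>j\<in>UNIV. z j * theta_par E mu nu muh nuh xis j)"
proof -
  let ?z = "zstar xis nu"
  have "(\<Sum>i\<in>UNIV. y i * (\<Sum>j\<in>{j. (i, j) \<in> E}. mu i j * xis i j * nuh j + muh i j * ?z i j)) =
     (\<Sum>i\<in>UNIV. \<Sum>j\<in>{j. (i, j) \<in> E}. z j * (xis i j * nuh j + muh i j / mu i j * ?z i j))"
    unfolding sum_distrib_left
  proof (intro sum.cong refl)
    fix i j assume "j \<in> {j. (i, j) \<in> E}"
    then have "z j = y i * mu i j" "mu i j > 0" using yz mu by auto
    then show "y i * (mu i j * xis i j * nuh j + muh i j * ?z i j) = z j * (xis i j * nuh j + muh i j / mu i j * ?z i j)"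
      by (simp add: field_simps)
  qed
  also have "\<dots> = (\<Sum>j\<in>UNIV. z j * ((\<Sum>i\<in>{i. (i, j) \<in> E}. xis i j) * nuh j + (\<Sum>i\<in>{i. (i, j) \<in> E}. muh i j / mu i j * ?z i j)))"
    unfolding sum_rows_eq_sum_cols by (simp only: sum_distrib_left[symmetric] sum_distrib_right sum.distrib)
  also have "\<dots> = (\<Sum>j\<in>UNIV. z j * theta_par E mu nu muh nuh xis j)"
    by (simp add: sum_edges_eq_sum_UNIV[OF assms(3)] one theta_par_def)
  finally show ?thesis
    by (simp add: h_par_def right_diff_distrib sum_subtractf)
qed

text \<open>All constraints can be met with equality. Multiplied by the weights they prescribe the
  marginals of an array on the tree, which exists once the totals agree; this scalar equation
  determines \<open>t\<close>, and optimality gives \<open>t \<le> vt\<close>.\<close>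

lemma swss_value_ge:
  fixes E :: "('i::finite \<times> 'j::finite) set"
  assumes "is_tree E" and yz: "\<And>i j. (i, j) \<in> E \<Longrightarrow> y i * mu i j = z j"
    and y: "\<And>i. 0 < y i" and z: "\<And>j. 0 < z j"
    and p: "\<And>i. 0 < p i"
    and vt: "is_swss_value E mu theta lamh p vt"
  shows "(\<Sum>j\<in>UNIV. z j * theta j) - (\<Sum>i\<in>UNIV. y i * lamh i) \<le> vt * (\<Sum>i\<in>UNIV. y i * p i)"
proof -
  have yp: "(\<Sum>i\<in>UNIV. y i * p i) > 0"
    by (intro sum_pos) (auto simp: y p)
  define t where "t = ((\<Sum>j\<in>UNIV. z j * theta j) - (\<Sum>i\<in>UNIV. y i * lamh i)) / (\<Sum>i\<in>UNIV. y i * p i)"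
  have t: "t * (\<Sum>i\<in>UNIV. y i * p i) = (\<Sum>j\<in>UNIV. z j * theta j) - (\<Sum>i\<in>UNIV. y i * lamh i)"
    using yp by (simp add: t_def)
  have "(\<Sum>i\<in>UNIV. y i * (lamh i + t * p i)) = (\<Sum>i\<in>UNIV. y i * lamh i) + t * (\<Sum>i\<in>UNIV. y i * p i)"
    by (simp add: distrib_left sum.distrib sum_distrib_left mult_ac)
  then have "(\<Sum>i\<in>UNIV. y i * (lamh i + t * p i)) = (\<Sum>j\<in>UNIV. z j * theta j)"
    using t by simp
  from tree_array_exists[OF assms(1) this] obtain \<psi> where \<psi>: "in_G E \<psi>"
    "\<And>i. (\<Sum>j\<in>UNIV. \<psi> i j) = y i * (lamh i + t * p i)" "\<And>j. (\<Sum>i\<in>UNIV. \<psi> i j) = z j * theta j"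
    by metis
  \<comment> \<open>Dividing by \<open>z j\<close> undoes the column weights; since
    \<open>mu i j / z j\<close> is \<open>1 / y i\<close> on edges, it undoes the row weights as
    well.\<close>
  have "swss_feasible E mu theta lamh p t (\<lambda>i j. \<psi> i j / z j)"
    unfolding swss_feasible_def
  proof (intro conjI allI)
    show "in_G E (\<lambda>i j. \<psi> i j / z j)"
      using \<psi>(1) by (auto simp: in_G_def)
    fix i
    have "(\<Sum>j\<in>{j. (i, j) \<in> E}. mu i j * (\<psi> i j / z j)) = (\<Sum>j\<in>{j. (i, j) \<in> E}. \<psi> i j / y i)"
    proof (intro sum.cong refl)
      fix j assume "j \<in> {j. (i, j) \<in> E}"
      then show "mu i j * (\<psi> i j / z j) = \<psi> i j / y i"
        using yz[of i j] y[of i] z[of j] by (auto simp: field_simps)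
    qed
    also have "\<dots> = lamh i + t * p i"
      using y[of i] by (simp add: sum_edges_eq_sum_UNIV[OF \<psi>(1)] \<psi>(2) flip: sum_divide_distrib)
    finally show "lamh i \<le> (\<Sum>j\<in>{j. (i, j) \<in> E}. mu i j * (\<psi> i j / z j)) - t * p i"
      by simp
  next
    fix j show "(\<Sum>i\<in>{i. (i, j) \<in> E}. \<psi> i j / z j) = theta j"
      using z[of j] by (simp add: sum_edges_eq_sum_UNIV[OF \<psi>(1)] \<psi>(3) flip: sum_divide_distrib)
  qed
  then have "t \<le> vt"
    using vt by (auto simp: is_swss_value_def)
  then show ?thesis
    using yp t by (metis mult_right_mono less_imp_le)
qed

section \<open>Gaussian vectors and Brownian motion\<close>

lemma sets_gauss_vec [simp]: "sets (gauss_vec h) = sets borel"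
  by (simp add: gauss_vec_def)

lemma emeasure_gauss_vec:
  fixes B :: "(real^'i::finite) set"
  assumes "B \<in> sets borel"
  shows "emeasure (gauss_vec h) B =
    (\<integral>\<^sup>+x. ennreal ((2 * pi * h) powr (- real CARD('i) / 2) * exp (- (norm x)\<^sup>2 / (2 * h))) * indicator B x \<partial>lborel)"
  using assms unfolding gauss_vec_def by (subst emeasure_density) auto

text \<open>Substitution by the factor \<open>sqrt h\<close>: the Jacobian
  \<open>sqrt h ^ CARD('i)\<close> absorbs the power of \<open>h\<close> in the normalising
  constant, so the value of the Gaussian integral does not enter.\<close>

lemma emeasure_gauss_vec_scale:
  fixes B :: "(real^'i::finite) set"
  assumes [measurable]: "B \<in> sets borel" and h: "h > 0"
  shows "emeasure (gauss_vec h) B = emeasure (gauss_vec 1) {x. sqrt h *\<^sub>R x \<in> B}"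
proof -
  let ?n = "real CARD('i)"
  have [measurable]: "{x. sqrt h *\<^sub>R x \<in> B} \<in> sets borel" by measurable
  have c: "sqrt h ^ CARD('i) * (2 * pi * h) powr (- ?n / 2) = (2 * pi * 1) powr (- ?n / 2)"
  proof -
    have "sqrt h ^ CARD('i) = h powr (?n / 2)"
      using h by (simp add: powr_half_sqrt[symmetric] powr_powr flip: powr_realpow)
    then show ?thesis
      using h by (simp add: powr_mult powr_add[symmetric] mult.left_commute)
  qed
  have "emeasure (gauss_vec h) B =
    (\<integral>\<^sup>+x. ennreal ((2 * pi * h) powr (- ?n / 2) * exp (- (norm x)\<^sup>2 / (2 * h))) * indicator B x
      \<partial>density (distr lborel borel (\<lambda>x::real^'i. 0 + sqrt h *\<^sub>R x)) (\<lambda>_. \<bar>sqrt h\<bar>^DIM(real^'i)))"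
    using h by (subst lborel_affine[of "sqrt h" 0, symmetric]) (auto simp: emeasure_gauss_vec)
  also have "\<dots> = (\<integral>\<^sup>+x. ennreal (sqrt h ^ CARD('i)) *
      (ennreal ((2 * pi * h) powr (- ?n / 2) * exp (- (norm (sqrt h *\<^sub>R x))\<^sup>2 / (2 * h))) * indicator B (sqrt h *\<^sub>R x)) \<partial>lborel)"
    using h by (subst nn_integral_density; simp) (subst nn_integral_distr; simp)
  also have "\<dots> = (\<integral>\<^sup>+x. ennreal ((2 * pi * 1) powr (- ?n / 2) * exp (- (norm x)\<^sup>2 / (2 * 1))) * indicator {x. sqrt h *\<^sub>R x \<in> B} x \<partial>lborel)"
  proof (intro nn_integral_cong)
    fix x :: "real^'i"
    have "exp (- (norm (sqrt h *\<^sub>R x))\<^sup>2 / (2 * h)) = exp (- (norm x)\<^sup>2 / (2 * 1))"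
      using h by (simp add: power_mult_distrib)
    then show "ennreal (sqrt h ^ CARD('i)) *
      (ennreal ((2 * pi * h) powr (- ?n / 2) * exp (- (norm (sqrt h *\<^sub>R x))\<^sup>2 / (2 * h))) * indicator B (sqrt h *\<^sub>R x))
      = ennreal ((2 * pi * 1) powr (- ?n / 2) * exp (- (norm x)\<^sup>2 / (2 * 1))) * indicator {x. sqrt h *\<^sub>R x \<in> B} x"
      using h by (simp only: c[symmetric]) (simp add: ennreal_mult' mult.assoc split: split_indicator)
  qed
  also have "\<dots> = emeasure (gauss_vec 1) {x. sqrt h *\<^sub>R x \<in> B}"
    by (subst emeasure_gauss_vec) auto
  finally show ?thesis .
qed

text \<open>The density is strictly positive, so mass zero would make \<open>B\<close> Lebesgue
  negligible, which a nonempty open set is not.\<close>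

lemma emeasure_gauss_vec_open_pos:
  fixes B :: "(real^'i::finite) set"
  assumes B: "open B" "B \<noteq> {}" and h: "h > 0"
  shows "emeasure (gauss_vec h) B > 0"
proof (rule ccontr)
  let ?f = "\<lambda>x::real^'i. ennreal ((2 * pi * h) powr (- real CARD('i) / 2) * exp (- (norm x)\<^sup>2 / (2 * h))) * indicator B x"
  have [measurable]: "B \<in> sets borel" using B by simp
  assume "\<not> emeasure (gauss_vec h) B > 0"
  then have "(\<integral>\<^sup>+x. ?f x \<partial>lborel) = 0"
    by (simp add: emeasure_gauss_vec)
  then have "AE x in lborel. ?f x = 0"
    by (subst (asm) nn_integral_0_iff_AE) auto
  then have "AE x in lborel. x \<notin> B"
    by eventually_elim (use h in \<open>auto split: split_indicator_asm simp: ennreal_eq_0_iff mult_le_0_iff\<close>)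
  then have "B \<in> null_sets lborel"
    using AE_iff_null_sets[of B lborel] by simp
  then have "negligible B"
    by (simp add: negligible_iff_null_sets null_sets_completionI)
  then show False
    using open_not_negligible B by blast
qed

text \<open>Source of bounds uniform in time: \<open>s = 0\<close> gives the constant of the maximal
  inequality, \<open>s = 1\<close> a fluctuation of order \<open>sqrt h\<close> with fixed
  probability.\<close>

lemma emeasure_gauss_vec_halfspace:
  fixes a :: "real^'i::finite"
  assumes h: "h > 0"
  shows "emeasure (gauss_vec h) {x. s * sqrt h \<le> a \<bullet> x} = emeasure (gauss_vec 1) {x. s \<le> a \<bullet> x}"
proof -
  have [measurable]: "{x. s * sqrt h \<le> a \<bullet> x} \<in> sets borel" by measurable
  have "{x. sqrt h *\<^sub>R x \<in> {x. s * sqrt h \<le> a \<bullet> x}} = {x. s \<le> a \<bullet> x}"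
    using h by (auto simp: mult.commute)
  then show ?thesis
    using emeasure_gauss_vec_scale[of "{x. s * sqrt h \<le> a \<bullet> x}" h] h by simp
qed

lemma emeasure_gauss_vec_halfspace_pos:
  fixes a :: "real^'i::finite"
  assumes a: "a \<noteq> 0" and h: "h > 0"
  shows "emeasure (gauss_vec h) {x. s \<le> a \<bullet> x} > 0"
proof -
  have "0 < emeasure (gauss_vec h) {x. s < a \<bullet> x}"
  proof (intro emeasure_gauss_vec_open_pos h)
    show "open {x. s < a \<bullet> x}" by (simp add: open_halfspace_gt)
    \<comment> \<open>The multiple of \<open>a\<close> whose inner product with \<open>a\<close> is
      \<open>\<bar>s\<bar> + 1\<close>.\<close>
    have "((\<bar>s\<bar> + 1) / (a \<bullet> a)) *\<^sub>R a \<in> {x. s < a \<bullet> x}" using a by simp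
    then show "{x. s < a \<bullet> x} \<noteq> {}" by blast
  qed
  also have "\<dots> \<le> emeasure (gauss_vec h) {x. s \<le> a \<bullet> x}"
    by (intro emeasure_mono) auto
  finally show ?thesis .
qed

text \<open>Half of the Gaussian exponent already gives the tail; the other half is the density of
  the law with doubled variance.\<close>

lemma emeasure_gauss_vec_tail:
  fixes B :: "(real^'i::finite) set"
  assumes h: "h > 0" and r: "r \<ge> 0" and B: "B \<in> sets borel" "\<And>x. x \<in> B \<Longrightarrow> r \<le> norm x"
  shows "emeasure (gauss_vec h) B \<le>
    ennreal (2 powr (CARD('i) / 2) * exp (- r\<^sup>2 / (4 * h))) * emeasure (gauss_vec (2 * h)) (UNIV :: (real^'i) set)"
proof -
  let ?n = "real CARD('i)"
  let ?C = "2 powr (?n / 2) * exp (- r\<^sup>2 / (4 * h))"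
  \<comment> \<open>Doubling the variance costs the factor \<open>2 powr (?n / 2)\<close> in the
    normalising constant.\<close>
  have c: "(2 * pi * h) powr (- ?n / 2) = 2 powr (?n / 2) * (2 * pi * (2 * h)) powr (- ?n / 2)"
  proof -
    have "(2 * pi * (2 * h)) powr (- ?n / 2) = 2 powr (- ?n / 2) * (2 * pi * h) powr (- ?n / 2)"
      using h by (subst powr_mult[symmetric]) (auto simp: mult_ac)
    then show ?thesis
      by (simp add: powr_add[symmetric] flip: mult.assoc)
  qed
  have "emeasure (gauss_vec h) B =
    (\<integral>\<^sup>+x. ennreal ((2 * pi * h) powr (- ?n / 2) * exp (- (norm x)\<^sup>2 / (2 * h))) * indicator B x \<partial>lborel)"
    using B(1) by (rule emeasure_gauss_vec)
  also have "\<dots> \<le> (\<integral>\<^sup>+x. ennreal ?C * (ennreal ((2 * pi * (2 * h)) powr (- ?n / 2) * exp (- (norm x)\<^sup>2 / (2 * (2 * h)))) * indicator (UNIV :: (real^'i) set) x) \<partial>lborel)"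
  proof (intro nn_integral_mono)
    fix x :: "real^'i"
    show "ennreal ((2 * pi * h) powr (- ?n / 2) * exp (- (norm x)\<^sup>2 / (2 * h))) * indicator B x
      \<le> ennreal ?C * (ennreal ((2 * pi * (2 * h)) powr (- ?n / 2) * exp (- (norm x)\<^sup>2 / (2 * (2 * h)))) * indicator (UNIV :: (real^'i) set) x)"
    proof (cases "x \<in> B")
      case True
      then have "r\<^sup>2 \<le> (norm x)\<^sup>2"
        using B(2) r by (intro power_mono) auto
      then have "- (norm x)\<^sup>2 / (2 * h) \<le> - r\<^sup>2 / (4 * h) + (- (norm x)\<^sup>2 / (2 * (2 * h)))"
        using h by (simp add: field_simps)
      then have "exp (- (norm x)\<^sup>2 / (2 * h)) \<le> exp (- r\<^sup>2 / (4 * h)) * exp (- (norm x)\<^sup>2 / (2 * (2 * h)))"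
        by (simp only: exp_add[symmetric] exp_le_cancel_iff)
      then have "2 powr (?n / 2) * (2 * pi * (2 * h)) powr (- ?n / 2) * exp (- (norm x)\<^sup>2 / (2 * h)) \<le>
         2 powr (?n / 2) * (2 * pi * (2 * h)) powr (- ?n / 2) * (exp (- r\<^sup>2 / (4 * h)) * exp (- (norm x)\<^sup>2 / (2 * (2 * h))))"
        by (intro mult_left_mono) auto
      also have "\<dots> = ?C * ((2 * pi * (2 * h)) powr (- ?n / 2) * exp (- (norm x)\<^sup>2 / (2 * (2 * h))))"
        by (simp only: mult_ac)
      finally show ?thesis
        using True unfolding c by (simp add: ennreal_leI flip: ennreal_mult')
    qed simp
  qed
  also have "\<dots> = ennreal ?C * emeasure (gauss_vec (2 * h)) (UNIV :: (real^'i) set)"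
    by (subst nn_integral_cmult) (auto simp: emeasure_gauss_vec)
  finally show ?thesis .
qed

section \<open>Brownian motion relative to a filtration\<close>

locale brownian = prob_space M for M :: "'a measure" +
  fixes F :: "real \<Rightarrow> 'a measure" and W :: "real \<Rightarrow> 'a \<Rightarrow> real^'i::finite"
  assumes filtration: "is_filtration M F" and BM: "is_BM_wrt M F W"
begin

lemma subalgebra_F: "subalgebra M (F t)" "s \<le> t \<Longrightarrow> subalgebra (F t) (F s)"
  using filtration by (auto simp: is_filtration_def subalgebra_def)

lemma space_F: "space (F t) = space M"
  using subalgebra_F(1) by (auto simp: subalgebra_def)

lemma sets_F: "A \<in> sets (F t) \<Longrightarrow> A \<in> sets M"
  using subalgebra_F(1) by (auto simp: subalgebra_def)

lemma W_measurable_F: "0 \<le> s \<Longrightarrow> s \<le> t \<Longrightarrow> W s \<in> borel_measurable (F t)"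
  using BM by (intro measurable_from_subalg[OF subalgebra_F(2)[of s t]]) (auto simp: is_BM_wrt_def)

lemma W_measurable: "0 \<le> s \<Longrightarrow> W s \<in> borel_measurable M"
  using measurable_from_subalg[OF subalgebra_F(1) W_measurable_F[of s s]] by simp

lemma AE_W_continuous: "AE \<omega> in M. W 0 \<omega> = 0 \<and> continuous_on {0..} (\<lambda>t. W t \<omega>)"
  using BM by (simp add: is_BM_wrt_def)

lemma prob_increment:
  assumes "0 \<le> s" "s < t" "A \<in> sets (F s)" "B \<in> sets borel"
  shows "prob (A \<inter> {\<omega>\<in>space M. W t \<omega> - W s \<omega> \<in> B}) = prob A * measure (gauss_vec (t - s)) B"
  using BM assms by (simp add: is_BM_wrt_def)

text \<open>The increment law with the whole space as \<open>A\<close> and \<open>B = UNIV\<close>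
  forces total mass one, so no Gaussian integral has to be computed.\<close>

lemma prob_space_gauss_vec:
  assumes "h > 0"
  shows "prob_space (gauss_vec h :: (real^'i) measure)"
proof -
  have "measure (gauss_vec h) (UNIV :: (real^'i) set) = 1"
    using prob_increment[of 0 h "space M" UNIV] assms sets.top[of "F 0"] by (simp add: space_F prob_space)
  \<comment> \<open>\<open>measure\<close> sends infinite mass to zero, so the value 1 excludes
    it.\<close>
  then have "emeasure (gauss_vec h) (UNIV :: (real^'i) set) = 1"
    by (metis emeasure_eq_ennreal_measure ennreal_1 measure_eq_emeasure_eq_ennreal zero_le_one enn2real_top measure_def zero_neq_one)
  then show ?thesis
    by (intro prob_spaceI) (simp add: gauss_vec_def)
qed

lemma prob_W:
  assumes t: "t > 0" and B: "B \<in> sets borel"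
  shows "prob {\<omega>\<in>space M. W t \<omega> \<in> B} = measure (gauss_vec t) B"
proof -
  note [measurable] = W_measurable B
  have "prob {\<omega>\<in>space M. W t \<omega> \<in> B} = prob (space M \<inter> {\<omega>\<in>space M. W t \<omega> - W 0 \<omega> \<in> B})"
    using t AE_W_continuous by (intro finite_measure_eq_AE) auto
  then show ?thesis
    using prob_increment[of 0 t "space M" B] t B sets.top[of "F 0"] by (simp add: space_F prob_space)
qed

lemma measure_gauss_vec_halfspace:
  fixes a :: "real^'i"
  assumes "h > 0"
  shows "measure (gauss_vec h) {x. s * sqrt h \<le> a \<bullet> x} = measure (gauss_vec 1) {x. s \<le> a \<bullet> x}"
  using emeasure_gauss_vec_halfspace[OF assms, of s a] by (simp add: measure_def)

lemma measure_gauss_vec_halfspace_pos: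
  fixes a :: "real^'i"
  assumes "a \<noteq> 0" "h > 0"
  shows "measure (gauss_vec h) {x. s \<le> a \<bullet> x} > 0"
proof -
  interpret g: prob_space "gauss_vec h :: (real^'i) measure"
    by (rule prob_space_gauss_vec[OF assms(2)])
  show ?thesis
    using emeasure_gauss_vec_halfspace_pos[OF assms] g.emeasure_eq_measure by simp
qed

section \<open>Maximal inequality and sublinear growth\<close>

text \<open>On the event that \<open>s\<close> is the first time in \<open>S\<close> at which the level is exceeded, the increment
  from \<open>s\<close> to \<open>T\<close> is independent of the past and nonnegative with probability \<open>\<delta>\<close>.\<close>

lemma maximal_inequality_finite:
  fixes b :: "real^'i"
  defines "\<delta> \<equiv> measure (gauss_vec 1) {x. 0 \<le> b \<bullet> x}"
  assumes S: "finite S" "S \<subseteq> {0..T}"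
  shows "\<delta> * prob {\<omega>\<in>space M. \<exists>s\<in>S. r < b \<bullet> W s \<omega>} \<le> prob {\<omega>\<in>space M. r < b \<bullet> W T \<omega>}"
proof (cases "S = {}")
  case False
  then have T: "0 \<le> T" using S by auto
  have \<delta>: "\<delta> \<le> 1"
    unfolding \<delta>_def by (intro prob_space.prob_le_1 prob_space_gauss_vec) simp
  have H [measurable]: "{x. 0 \<le> b \<bullet> x} \<in> sets borel" by measurable
  define A where "A s = {\<omega>\<in>space M. r < b \<bullet> W s \<omega> \<and> (\<forall>l\<in>{l\<in>S. l < s}. b \<bullet> W l \<omega> \<le> r)}" for s
  define G where "G s = A s \<inter> {\<omega>\<in>space M. W T \<omega> - W s \<omega> \<in> {x. 0 \<le> b \<bullet> x}}" for s
  \<comment> \<open>\<open>A s\<close> depends on times up to \<open>s\<close> only, which is what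
    independence of the later increment requires.\<close>
  have A_F: "A s \<in> sets (F s)" if "s \<in> S" for s
  proof -
    have [measurable]: "W l \<in> borel_measurable (F s)" if "l \<in> S" "l \<le> s" for l
      using that S by (intro W_measurable_F) auto
    have [measurable]: "W s \<in> borel_measurable (F s)"
      using \<open>s \<in> S\<close> by simp
    have "{\<omega>\<in>space (F s). r < b \<bullet> W s \<omega> \<and> (\<forall>l\<in>{l\<in>S. l < s}. b \<bullet> W l \<omega> \<le> r)} \<in> sets (F s)"
      using S(1) by (intro sets.sets_Collect sets.sets_Collect_finite_All) auto
    then show ?thesis by (simp add: A_def space_F)
  qed
  have G_sets: "G s \<in> sets M" if "s \<in> S" for s
  proof -
    have [measurable]: "W T \<in> borel_measurable M" "W s \<in> borel_measurable M"
      using that S T by (auto intro!: W_measurable)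
    show ?thesis
      unfolding G_def using sets_F[OF A_F[OF that]] by (intro sets.Int) auto
  qed
  \<comment> \<open>The increment law covers \<open>s < T\<close> only. For \<open>s = T\<close> the
    increment is zero and \<open>\<delta> \<le> 1\<close> suffices.\<close>
  have G_prob: "\<delta> * prob (A s) \<le> prob (G s)" if "s \<in> S" for s
  proof (cases "s = T")
    case True
    then have "G s = A s" by (auto simp: G_def A_def)
    then show ?thesis using \<delta> by (simp add: mult_left_le_one_le \<delta>_def)
  next
    case False
    then have s: "0 \<le> s" "s < T" using S that by (auto simp: less_le)
    have "prob (G s) = prob (A s) * measure (gauss_vec (T - s)) {x. 0 \<le> b \<bullet> x}"
      unfolding G_def using s by (intro prob_increment A_F that H)
    then show ?thesis
      using measure_gauss_vec_halfspace[of "T - s" 0 b] s by (simp add: \<delta>_def)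
  qed
  have disj: "disjoint_family_on A S"
    by (auto simp: disjoint_family_on_def A_def) (metis linorder_neq_iff not_less)
  have "{\<omega>\<in>space M. \<exists>s\<in>S. r < b \<bullet> W s \<omega>} = (\<Union>s\<in>S. A s)"
  proof safe
    fix \<omega> s assume \<omega>: "\<omega> \<in> space M" "s \<in> S" "r < b \<bullet> W s \<omega>"
    \<comment> \<open>The least time of exceedance in \<open>S\<close> tells which of the sets
      \<open>A s\<close> contains \<open>\<omega>\<close>.\<close>
    define Q where "Q = {s\<in>S. r < b \<bullet> W s \<omega>}"
    have Q: "finite Q" "Q \<noteq> {}" using \<omega> S by (auto simp: Q_def)
    have "Min Q \<in> Q" using Q by (rule Min_in)
    moreover have "b \<bullet> W l \<omega> \<le> r" if "l \<in> S" "l < Min Q" for l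
      using that Min_le[of Q l] Q by (auto simp: Q_def not_le[symmetric])
    ultimately show "\<omega> \<in> (\<Union>s\<in>S. A s)"
      using \<omega>(1) by (auto simp: A_def Q_def)
  qed (auto simp: A_def)
  then have "\<delta> * prob {\<omega>\<in>space M. \<exists>s\<in>S. r < b \<bullet> W s \<omega>} = (\<Sum>s\<in>S. \<delta> * prob (A s))"
    using finite_measure_finite_Union[OF S(1) _ disj] sets_F[OF A_F] by (simp add: sum_distrib_left image_subset_iff)
  also have "\<dots> \<le> (\<Sum>s\<in>S. prob (G s))"
    by (intro sum_mono G_prob)
  also have "\<dots> = prob (\<Union>s\<in>S. G s)"
    using disj G_sets by (intro finite_measure_finite_Union[symmetric] S) (auto simp: disjoint_family_on_def G_def)
  also have "\<dots> \<le> prob {\<omega>\<in>space M. r < b \<bullet> W T \<omega>}"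
  proof (intro finite_measure_mono)
    show "(\<Union>s\<in>S. G s) \<subseteq> {\<omega>\<in>space M. r < b \<bullet> W T \<omega>}"
      by (auto simp: G_def A_def inner_diff_right)
    have [measurable]: "W T \<in> borel_measurable M" using T by (rule W_measurable)
    show "{\<omega>\<in>space M. r < b \<bullet> W T \<omega>} \<in> events" by measurable
  qed
  finally show ?thesis .
qed simp

text \<open>Continuity of the measure along an enumeration extends the finite case. Restricting to
  rational times keeps the event a countable union; path continuity is invoked only later.\<close>

lemma maximal_inequality_rat:
  fixes b :: "real^'i"
  defines "\<delta> \<equiv> measure (gauss_vec 1) {x. 0 \<le> b \<bullet> x}"
  assumes T: "0 \<le> T"
  shows "\<delta> * prob {\<omega>\<in>space M. \<exists>s\<in>\<rat> \<inter> {0..T}. r < b \<bullet> W s \<omega>} \<le> prob {\<omega>\<in>space M. r < b \<bullet> W T \<omega>}"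
proof -
  define D where "D = \<rat> \<inter> {0..T}"
  have D: "countable D" "D \<noteq> {}"
    using T by (auto simp: D_def countable_rat intro!: countable_Int1)
  define A where "A n = {\<omega>\<in>space M. \<exists>s\<in>from_nat_into D ` {..n}. r < b \<bullet> W s \<omega>}" for n :: nat
  have fD: "from_nat_into D n \<in> {0..T}" for n
    using from_nat_into[OF D(2), of n] by (auto simp: D_def)
  have meas: "W (from_nat_into D n) \<in> borel_measurable M" for n
    using fD[of n] by (intro W_measurable) auto
  have "A n \<in> events" for n
    unfolding A_def using meas by (intro sets.sets_Collect_finite_Ex) auto
  moreover have "incseq A"
    by (auto simp: incseq_def A_def)
  moreover have "(\<Union>n. A n) = {\<omega>\<in>space M. \<exists>s\<in>D. r < b \<bullet> W s \<omega>}"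
  proof -
    have "(\<exists>n. \<exists>s\<in>from_nat_into D ` {..n}. r < b \<bullet> W s \<omega>) \<longleftrightarrow> (\<exists>s\<in>range (from_nat_into D). r < b \<bullet> W s \<omega>)" for \<omega>
      by auto
    then show ?thesis using D by (auto simp: A_def range_from_nat_into)
  qed
  ultimately have "(\<lambda>n. prob (A n)) \<longlonglongrightarrow> prob {\<omega>\<in>space M. \<exists>s\<in>D. r < b \<bullet> W s \<omega>}"
    using finite_Lim_measure_incseq[of A] by auto
  then have "(\<lambda>n. \<delta> * prob (A n)) \<longlonglongrightarrow> \<delta> * prob {\<omega>\<in>space M. \<exists>s\<in>D. r < b \<bullet> W s \<omega>}"
    by (rule tendsto_mult_left)
  moreover have "\<delta> * prob (A n) \<le> prob {\<omega>\<in>space M. r < b \<bullet> W T \<omega>}" for n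
    unfolding \<delta>_def A_def using fD by (intro maximal_inequality_finite) auto
  ultimately show ?thesis
    unfolding D_def by (intro LIMSEQ_le_const2) auto
qed

text \<open>By Cauchy-Schwarz, \<open>r < b \<bullet> x\<close> forces
  \<open>r / norm b \<le> norm x\<close>, so the tail bound for the norm applies; its comparison law
  has mass one.\<close>

lemma prob_W_tail:
  fixes b :: "real^'i"
  assumes t: "t > 0" and r: "r \<ge> 0" and b: "b \<noteq> 0"
  shows "prob {\<omega>\<in>space M. r < b \<bullet> W t \<omega>} \<le> 2 powr (CARD('i) / 2) * exp (- (r / norm b)\<^sup>2 / (4 * t))"
proof -
  interpret g: prob_space "gauss_vec t :: (real^'i) measure"
    using t by (rule prob_space_gauss_vec)
  interpret g2: prob_space "gauss_vec (2 * t) :: (real^'i) measure"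
    using t by (intro prob_space_gauss_vec) simp
  have "r / norm b \<le> norm x" if "r < b \<bullet> x" for x
    using that norm_cauchy_schwarz[of b x] b by (simp add: field_simps)
  then have "emeasure (gauss_vec t) {x. r < b \<bullet> x} \<le>
      ennreal (2 powr (CARD('i) / 2) * exp (- (r / norm b)\<^sup>2 / (4 * t))) * emeasure (gauss_vec (2 * t)) (UNIV :: (real^'i) set)"
    using t r by (intro emeasure_gauss_vec_tail) auto
  also have "emeasure (gauss_vec (2 * t)) (UNIV :: (real^'i) set) = 1"
    using g2.emeasure_space_1 by (simp add: gauss_vec_def)
  finally have "measure (gauss_vec t) {x. r < b \<bullet> x} \<le> 2 powr (CARD('i) / 2) * exp (- (r / norm b)\<^sup>2 / (4 * t))"
    by (simp add: g.emeasure_eq_measure)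
  then show ?thesis
    using prob_W[of t "{x. r < b \<bullet> x}"] t by simp
qed

text \<open>Borel-Cantelli over unit time blocks: by the maximal inequality and the Gaussian tail,
  exceeding \<open>c * n\<close> by time \<open>n + 1\<close> has geometrically small
  probability.\<close>

lemma AE_eventually_W_le:
  fixes b :: "real^'i"
  assumes b: "b \<noteq> 0" and c: "c > 0"
  shows "AE \<omega> in M. eventually (\<lambda>t. b \<bullet> W t \<omega> \<le> c * t) at_top"
proof -
  define \<delta> where "\<delta> = measure (gauss_vec 1) {x. 0 \<le> b \<bullet> x}"
  have \<delta>: "\<delta> > 0"
    unfolding \<delta>_def using b by (rule measure_gauss_vec_halfspace_pos) simp
  \<comment> \<open>Since \<open>n / (n + 1) \<ge> 1 / 2\<close> for \<open>n \<ge> 1\<close>, the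
    exponent of the tail bound at time \<open>n + 1\<close> is at least
    \<open>k * n\<close>.\<close>
  define k where "k = (c / norm b)\<^sup>2 / 8"
  have k: "k > 0" using b c by (simp add: k_def)
  define K where "K = 2 powr (CARD('i) / 2) / \<delta>"
  have K: "K \<ge> 0" using \<delta> by (simp add: K_def)
  \<comment> \<open>The level belongs to the left end of the block and the horizon to its right end,
    so a violation \<open>c * t < b \<bullet> W t \<omega>\<close> anywhere in the block exceeds the
    level.\<close>
  define A where "A n = {\<omega>\<in>space M. \<exists>s\<in>\<rat> \<inter> {0..real (Suc n)}. c * n < b \<bullet> W s \<omega>}" for n :: nat
  have A_sets: "A n \<in> events" for n
  proof -
    have [measurable]: "W s \<in> borel_measurable M" if "s \<in> \<rat> \<inter> {0..real (Suc n)}" for s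
      using that by (intro W_measurable) auto
    show ?thesis
      unfolding A_def by (intro sets.sets_Collect_countable_Ex' countable_Int1 countable_rat) auto
  qed
  have A_prob: "prob (A n) \<le> K * exp (- k) ^ n" for n
  proof -
    have "real n * (1 / 2) \<le> real n * (real n / real (Suc n))"
      by (cases n) (auto intro!: mult_left_mono simp: field_simps)
    then have "(c / norm b)\<^sup>2 / 4 * (n * (1 / 2)) \<le> (c / norm b)\<^sup>2 / 4 * (n * (n / real (Suc n)))"
      by (rule mult_left_mono) simp
    also have "(c / norm b)\<^sup>2 / 4 * (n * (1 / 2)) = k * n"
      by (simp add: k_def)
    also have "(c / norm b)\<^sup>2 / 4 * (n * (n / real (Suc n))) = (c * n / norm b)\<^sup>2 / (4 * real (Suc n))"
      by (simp add: power2_eq_square distrib_left mult_ac)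
    finally have *: "exp (- (c * n / norm b)\<^sup>2 / (4 * real (Suc n))) \<le> exp (- k) ^ n"
      by (simp add: mult.commute flip: exp_of_nat_mult)
    have "\<delta> * prob (A n) \<le> prob {\<omega>\<in>space M. c * n < b \<bullet> W (real (Suc n)) \<omega>}"
      unfolding \<delta>_def A_def by (intro maximal_inequality_rat) simp
    also have "\<dots> \<le> 2 powr (CARD('i) / 2) * exp (- (c * n / norm b)\<^sup>2 / (4 * real (Suc n)))"
      using b c by (intro prob_W_tail) auto
    also have "\<dots> \<le> 2 powr (CARD('i) / 2) * exp (- k) ^ n"
      using * by (intro mult_left_mono) auto
    finally show ?thesis
      using \<delta> by (simp add: K_def field_simps)
  qed
  have "summable (\<lambda>n. K * exp (- k) ^ n)"
    using k by (intro summable_mult summable_geometric) simp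
  then have "summable (\<lambda>n. prob (A n))"
    by (rule summable_comparison_test') (use A_prob in auto)
  then have "AE \<omega> in M. eventually (\<lambda>n. \<omega> \<in> space M - A n) sequentially"
    by (intro borel_cantelli_AE1 A_sets) (simp add: emeasure_eq_measure)
  with AE_W_continuous show ?thesis
  proof eventually_elim
    case (elim \<omega>)
    from elim(2) obtain N where N: "\<And>n. n \<ge> N \<Longrightarrow> \<omega> \<in> space M - A n"
      by (auto simp: eventually_sequentially)
    have "b \<bullet> W t \<omega> \<le> c * t" if t: "t \<ge> real N" for t
    proof (rule ccontr)
      assume "\<not> b \<bullet> W t \<omega> \<le> c * t"
      define n where "n = nat \<lfloor>t\<rfloor>"
      have n: "n \<ge> N" "real n \<le> t" "t < real (Suc n)"
        using t by (auto simp: n_def le_nat_floor) linarith+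
      have "c * n < b \<bullet> W t \<omega>"
        using \<open>\<not> b \<bullet> W t \<omega> \<le> c * t\<close> n c by (smt (verit) mult_left_mono)
      moreover have "continuous_on {0..} (\<lambda>t. b \<bullet> W t \<omega>)"
        using elim(1) by (intro continuous_intros) auto
      moreover have "t \<in> {0..}" using t by auto
      ultimately obtain d where d': "d > 0"
        "\<forall>s\<in>{0..}. dist s t < d \<longrightarrow> dist (b \<bullet> W s \<omega>) (b \<bullet> W t \<omega>) < b \<bullet> W t \<omega> - c * n"
        unfolding continuous_on_iff using diff_gt_0_iff_gt by blast
      \<comment> \<open>\<open>A n\<close> sees rational times only, while \<open>t\<close> may be
        irrational. Continuity carries the exceedance to a rational \<open>s\<close> slightly after
        \<open>t\<close> and still before \<open>Suc n\<close>.\<close>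
      have d: "c * n < b \<bullet> W s \<omega>" if "0 \<le> s" "dist s t < d" for s
        using bspec[OF d'(2), of s] that by (auto simp: dist_real_def)
      have "t < min (t + d) (real (Suc n))" using d'(1) n by simp
      then obtain s where s: "s \<in> \<rat>" "t < s" "s < min (t + d) (real (Suc n))"
        using Rats_dense_in_real by blast
      then have "c * n < b \<bullet> W s \<omega>"
        using t by (intro d) (auto simp: dist_real_def)
      then have "\<omega> \<in> A n"
        using s t N[OF n(1)] by (auto simp: A_def intro!: bexI[of _ s])
      then show False using N[OF n(1)] by auto
    qed
    then show ?case
      unfolding eventually_at_top_linorder by blast
  qed
qed

end

section \<open>Diffusions with a drift bounded below in one direction\<close>

text \<open>Pairing with \<open>y\<close> commutes with the time integral, so the lower bound on the
  drift can be integrated along the path; the diagonal dispersion matrix is moved from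
  \<open>W\<close> to \<open>y\<close>.\<close>

lemma weak_solution_inner_ge:
  fixes X :: "real \<Rightarrow> 'a \<Rightarrow> real^'i::finite"
  assumes sol: "weak_solution M F W X b v lam" and c: "\<And>x. c \<le> y \<bullet> b x (v x)"
  shows "AE \<omega> in M. \<forall>t\<ge>0. y \<bullet> X 0 \<omega> + c * t + (\<chi> i. sqrt (2 * lam i) * y $ i) \<bullet> W t \<omega> \<le> y \<bullet> X t \<omega>"
proof -
  from sol have "AE \<omega> in M. \<forall>t\<ge>0. (\<lambda>s. b (X s \<omega>) (v (X s \<omega>))) absolutely_integrable_on {0..t} \<and>
           X t \<omega> = X 0 \<omega> + integral {0..t} (\<lambda>s. b (X s \<omega>) (v (X s \<omega>)))
                   + (\<chi> i. sqrt (2 * lam i) * W t \<omega> $ i)"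
    by (auto simp: weak_solution_def)
  then show ?thesis
  proof eventually_elim
    case (elim \<omega>)
    show ?case
    proof (intro allI impI)
      fix t :: real assume t: "t \<ge> 0"
      let ?b = "\<lambda>s. b (X s \<omega>) (v (X s \<omega>))"
      have int: "?b integrable_on {0..t}"
        using elim t by (auto simp: absolutely_integrable_on_def)
      have "c * t = integral {0..t} (\<lambda>_. c)"
        using t by simp
      also have "\<dots> \<le> integral {0..t} (\<lambda>s. y \<bullet> ?b s)"
        using integrable_linear[OF int bounded_linear_inner_right[of y]] c
        by (intro integral_le) (auto simp: o_def)
      also have "\<dots> = y \<bullet> integral {0..t} ?b"
        using integral_linear[OF int bounded_linear_inner_right[of y]] by (simp add: o_def)
      finally have "c * t \<le> y \<bullet> integral {0..t} ?b" .
      moreover have "y \<bullet> (\<chi> i. sqrt (2 * lam i) * W t \<omega> $ i) = (\<chi> i. sqrt (2 * lam i) * y $ i) \<bullet> W t \<omega>"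
        by (simp add: inner_vec_def mult_ac)
      moreover have "X t \<omega> = X 0 \<omega> + integral {0..t} ?b + (\<chi> i. sqrt (2 * lam i) * W t \<omega> $ i)"
        using elim t by blast
      ultimately show "y \<bullet> X 0 \<omega> + c * t + (\<chi> i. sqrt (2 * lam i) * y $ i) \<bullet> W t \<omega> \<le> y \<bullet> X t \<omega>"
        by (simp add: inner_add_right)
    qed
  qed
qed

text \<open>The noise eventually consumes at most half of the drift, so
  \<open>y \<bullet> X t\<close> grows at least linearly and, by Cauchy-Schwarz, so does the
  norm.\<close>

lemma transient_if_inner_drift_pos:
  fixes b :: "real^'i::finite \<Rightarrow> 'u \<Rightarrow> real^'i"
  assumes c: "c > 0" "\<And>x. c \<le> y \<bullet> b x (v x)" and a: "(\<chi> i. sqrt (2 * lam i) * y $ i) \<noteq> 0"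
  shows "transient TYPE('a) b v lam"
  unfolding transient_def
proof (intro allI impI)
  fix x and M :: "'a measure" and F W X
  assume sol: "weak_solution M F W X b v lam"
  interpret brownian M F W
    using sol by (auto simp: weak_solution_def brownian_def brownian_axioms_def)
  let ?a = "\<chi> i. sqrt (2 * lam i) * y $ i"
  from c a have y: "y \<noteq> 0" by (auto simp: zero_vec_def)
  \<comment> \<open>A lower growth bound for \<open>?a \<bullet> W t\<close> is an upper one for
    \<open>- ?a\<close>; the rate \<open>c / 2\<close> leaves half of the drift.\<close>
  have "AE \<omega> in M. eventually (\<lambda>t. (- ?a) \<bullet> W t \<omega> \<le> c / 2 * t) at_top"
    using a c by (intro AE_eventually_W_le) (auto simp: neg_equal_0_iff_equal)
  with weak_solution_inner_ge[where c = c and y = y, OF sol c(2)]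
  show "AE \<omega> in M. filterlim (\<lambda>t. norm (X t \<omega>)) at_top at_top"
  proof eventually_elim
    case (elim \<omega>)
    have "eventually (\<lambda>t. (y \<bullet> X 0 \<omega> + c / 2 * t) / norm y \<le> norm (X t \<omega>)) at_top"
      using elim(2) eventually_ge_at_top[of 0]
    proof eventually_elim
      fix t :: real assume t: "(- ?a) \<bullet> W t \<omega> \<le> c / 2 * t" "0 \<le> t"
      have "y \<bullet> X 0 \<omega> + c / 2 * t \<le> y \<bullet> X t \<omega>"
        using elim(1) t by fastforce
      also have "\<dots> \<le> norm y * norm (X t \<omega>)"
        by (rule norm_cauchy_schwarz)
      finally show "(y \<bullet> X 0 \<omega> + c / 2 * t) / norm y \<le> norm (X t \<omega>)"
        using y by (simp add: field_simps)
    qed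
    moreover have "filterlim (\<lambda>t. (y \<bullet> X 0 \<omega> + c / 2 * t) / norm y) at_top at_top"
      using c y by real_asymp
    ultimately show ?case
      by (rule filterlim_at_top_mono[rotated])
  qed
qed

text \<open>Under an invariant law \<open>y \<bullet> X t\<close> would be tight, but it dominates \<open>y \<bullet> X 0\<close> plus a centred
  Gaussian of variance proportional to \<open>t\<close>.\<close>

lemma no_invariant_prob_if_inner_drift_nonneg:
  fixes b :: "real^'i::finite \<Rightarrow> 'u \<Rightarrow> real^'i"
  assumes c: "\<And>x. 0 \<le> y \<bullet> b x (v x)" and a: "(\<chi> i. sqrt (2 * lam i) * y $ i) \<noteq> 0"
  shows "\<not> has_invariant_prob TYPE('a) b v lam"
proof
  assume "has_invariant_prob TYPE('a) b v lam"
  then obtain M :: "'a measure" and F W X \<mu> where sol: "weak_solution M F W X b v lam"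
    and \<mu>: "\<And>t. 0 \<le> t \<Longrightarrow> distr M borel (X t) = \<mu>"
    unfolding has_invariant_prob_def by blast
  interpret brownian M F W
    using sol by (auto simp: weak_solution_def brownian_def brownian_axioms_def)
  let ?a = "\<chi> i. sqrt (2 * lam i) * y $ i"
  have X: "X t \<in> borel_measurable M" if "0 \<le> t" for t
    using sol that by (intro measurable_from_subalg[OF subalgebra_F(1)[of t]]) (auto simp: weak_solution_def)
  have law: "prob {\<omega>\<in>space M. X t \<omega> \<in> B} = measure \<mu> B" if "B \<in> sets borel" "0 \<le> t" for B t
    using that \<mu>[OF that(2)] measure_distr[OF X[OF that(2)], of B]
    by (auto simp: vimage_def Int_def conj_commute)
  \<comment> \<open>By scaling, this is the probability of
    \<open>?a \<bullet> W t \<ge> sqrt t\<close> at every \<open>t > 0\<close>.\<close>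
  define \<delta> where "\<delta> = measure (gauss_vec 1) {x. 1 \<le> ?a \<bullet> x}"
  have \<delta>: "\<delta> > 0"
    unfolding \<delta>_def using a by (rule measure_gauss_vec_halfspace_pos) simp
  have [measurable]: "X 0 \<in> borel_measurable M"
    by (simp add: X)
  have "(\<lambda>n. prob {\<omega>\<in>space M. real n \<le> \<bar>y \<bullet> X 0 \<omega>\<bar>}) \<longlonglongrightarrow> prob (\<Inter>n. {\<omega>\<in>space M. real n \<le> \<bar>y \<bullet> X 0 \<omega>\<bar>})"
    by (intro finite_Lim_measure_decseq) (auto simp: decseq_def)
  also have "(\<Inter>n. {\<omega>\<in>space M. real n \<le> \<bar>y \<bullet> X 0 \<omega>\<bar>}) = {}"
    using reals_Archimedean2 by (fastforce simp: not_le[symmetric])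
  finally have "eventually (\<lambda>n. prob {\<omega>\<in>space M. real n \<le> \<bar>y \<bullet> X 0 \<omega>\<bar>} < \<delta> / 2) sequentially"
    using \<delta> by (intro order_tendstoD(2)) auto
  \<comment> \<open>\<open>n\<close> is chosen from the law at time 0 alone; invariance transfers
    the bound to all times. Positivity of \<open>n\<close> ensures \<open>t > 0\<close>
    below.\<close>
  then obtain n where n: "n > 0" "prob {\<omega>\<in>space M. real n \<le> \<bar>y \<bullet> X 0 \<omega>\<bar>} < \<delta> / 2"
    by (metis (mono_tags, lifting) eventually_sequentially eventually_gt_at_top eventually_conj le_refl)
  define B where "B = {x. real n \<le> \<bar>y \<bullet> x\<bar>}"
  have B [measurable]: "B \<in> sets borel"
    unfolding B_def by measurable
  \<comment> \<open>Now \<open>sqrt t\<close> is \<open>2 * n\<close>, and a noise term of at least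
    \<open>2 * n\<close> makes \<open>y \<bullet> X\<close> have absolute value at least
    \<open>n\<close> at time 0 or at time \<open>t\<close>.\<close>
  define t where "t = (2 * real n)\<^sup>2"
  have t: "t > 0" "sqrt t = 2 * real n"
    using n real_sqrt_abs[of "2 * real n"] by (simp add: t_def, simp only: t_def abs_of_nat abs_mult abs_numeral)
  have [measurable]: "X t \<in> borel_measurable M" "W t \<in> borel_measurable M"
    using t by (auto intro: X W_measurable)
  have "\<delta> = measure (gauss_vec t) {x. 2 * real n \<le> ?a \<bullet> x}"
    using measure_gauss_vec_halfspace[OF t(1), of 1 ?a] t(2) by (simp add: \<delta>_def)
  also have "\<dots> = prob {\<omega>\<in>space M. 2 * real n \<le> ?a \<bullet> W t \<omega>}"
    using prob_W[OF t(1), of "{x. 2 * real n \<le> ?a \<bullet> x}"] by simp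
  also have "\<dots> \<le> prob ({\<omega>\<in>space M. X 0 \<omega> \<in> B} \<union> {\<omega>\<in>space M. X t \<omega> \<in> B})"
  proof (rule finite_measure_mono_AE)
    show "AE \<omega> in M. \<omega> \<in> {\<omega>\<in>space M. 2 * real n \<le> ?a \<bullet> W t \<omega>} \<longrightarrow>
        \<omega> \<in> {\<omega>\<in>space M. X 0 \<omega> \<in> B} \<union> {\<omega>\<in>space M. X t \<omega> \<in> B}"
      using weak_solution_inner_ge[where c = 0 and y = y, OF sol c]
    proof eventually_elim
      case (elim \<omega>)
      then have "y \<bullet> X 0 \<omega> + ?a \<bullet> W t \<omega> \<le> y \<bullet> X t \<omega>"
        using t(1) by simp
      then show ?case by (auto simp: B_def)
    qed
  qed measurable
  also have "\<dots> \<le> prob {\<omega>\<in>space M. X 0 \<omega> \<in> B} + prob {\<omega>\<in>space M. X t \<omega> \<in> B}"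
    by (intro measure_Un_le) measurable
  also have "\<dots> = 2 * prob {\<omega>\<in>space M. X 0 \<omega> \<in> B}"
    using t law[OF B] by simp
  also have "\<dots> < \<delta>"
    using n(2) by (simp add: B_def)
  finally show False by simp
qed

section \<open>Sign of the weighted drift in the two regimes of \<open>vt\<close>\<close>

theorem theorem5:
  fixes E :: "('i::finite \<times> 'j::finite) set"
    and lam lamh :: "'i \<Rightarrow> real" and nu nuh :: "'j \<Rightarrow> real" and mu muh :: "'i \<Rightarrow> 'j \<Rightarrow> real"
    and xis :: "'i \<Rightarrow> 'j \<Rightarrow> real" and p :: "'i \<Rightarrow> real" and vt :: real
  assumes tree: "is_tree E"
    and lam_pos: "\<forall>i. 0 < lam i" and nu_pos: "\<forall>j. 0 < nu j"
    and mu_pos: "\<forall>i j. (i, j) \<in> E \<longrightarrow> 0 < mu i j"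
    and crp: "crp_unique_solution E mu nu lam xis"
    and crp_sum: "\<forall>j. (\<Sum>i\<in>UNIV. xis i j) = 1"
    and crp_pos: "\<forall>i j. (i, j) \<in> E \<longrightarrow> 0 < xis i j"
    and p_pos: "\<forall>i. 0 < p i" and p_sum: "(\<Sum>i\<in>UNIV. p i) = 1"
    and vt: "is_swss_value E mu (theta_par E mu nu muh nuh xis) lamh p vt"
  shows "(vt < 0 \<longrightarrow> (\<forall>v. stat_markov_control v \<longrightarrow>
            transient TYPE('a) (drift E mu (h_par E mu nu lamh muh nuh xis)) v lam))
       \<and> (vt = 0 \<longrightarrow> (\<forall>v. stat_markov_control v \<longrightarrow>
            \<not> has_invariant_prob TYPE('a) (drift E mu (h_par E mu nu lamh muh nuh xis)) v lam))"
proof -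
  have mu: "\<And>i j. (i, j) \<in> E \<Longrightarrow> 0 < mu i j"
    using mu_pos by blast
  obtain y z where y: "\<And>i. 0 < y i" and z: "\<And>j. 0 < z j"
    and yz: "\<And>i j. (i, j) \<in> E \<Longrightarrow> y i * mu i j = z j"
    using tree_weights[where E = E and mu = mu, OF tree mu] by metis
  let ?h = "h_par E mu nu lamh muh nuh xis"
  let ?y = "\<chi> i. y i"
  \<comment> \<open>The part of the weighted drift that depends on neither the state nor the
    control.\<close>
  define c where "c = (\<Sum>i\<in>UNIV. y i * ?h i)"
  have yp: "0 < (\<Sum>i\<in>UNIV. y i * p i)"
    using y p_pos by (intro sum_pos) auto
  have "in_G E xis"
    using crp by (simp add: crp_unique_solution_def crp_feasible_def)
  \<comment> \<open>\<open>weighted_h_par\<close> identifies \<open>- c\<close> with the left side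
    of \<open>swss_value_ge\<close>.\<close>
  then have "- c \<le> vt * (\<Sum>i\<in>UNIV. y i * p i)"
    using weighted_h_par[where E = E and mu = mu and y = y and z = z and nu = nu and nuh = nuh
        and lamh = lamh and muh = muh and xis = xis, OF yz mu]
      swss_value_ge[where E = E and mu = mu and y = y and z = z and p = p, OF tree yz y z _ vt] crp_sum p_pos
    by (simp add: c_def)
  then have c: "vt < 0 \<Longrightarrow> 0 < c" "vt = 0 \<Longrightarrow> 0 \<le> c"
    using yp mult_neg_pos[of vt "\<Sum>i\<in>UNIV. y i * p i"] by auto
  \<comment> \<open>The idleness term is nonnegative for every admissible control, so the bound is
    uniform in \<open>x\<close> and \<open>v\<close>.\<close>
  have drift: "c \<le> ?y \<bullet> drift E mu ?h x (v x)" if "stat_markov_control v" for x v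
  proof -
    have "v x \<in> ctrl_set"
      using that by (simp add: stat_markov_control_def)
    moreover from this have "0 \<le> (\<Sum>j\<in>UNIV. z j * snd (v x) $ j)"
      using z by (intro sum_nonneg mult_nonneg_nonneg) (auto simp: ctrl_set_def less_imp_le)
    ultimately show ?thesis
      using weighted_drift[where E = E and mu = mu and y = y and z = z and u = "v x" and h = ?h and x = x,
          OF tree yz]
      by (simp add: inner_vec_def c_def negp_def)
  qed
  \<comment> \<open>All entries are positive: the noise does not degenerate in the direction
    \<open>?y\<close>.\<close>
  have "(\<chi> i. sqrt (2 * lam i) * ?y $ i) \<noteq> 0"
    using y lam_pos by (simp add: vec_eq_iff less_le)
  then show ?thesis
  proof (intro conjI impI allI)
    fix v :: "real^'i \<Rightarrow> (real^'i) \<times> (real^'j)"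
    assume a: "(\<chi> i. sqrt (2 * lam i) * ?y $ i) \<noteq> 0" and v: "stat_markov_control v"
    show "transient TYPE('a) (drift E mu ?h) v lam" if "vt < 0"
      using c(1)[OF that] drift[OF v] a by (rule transient_if_inner_drift_pos)
    show "\<not> has_invariant_prob TYPE('a) (drift E mu ?h) v lam" if "vt = 0"
      using order_trans[OF c(2)[OF that] drift[OF v]] a by (rule no_invariant_prob_if_inner_drift_nonneg)
  qed
qed

end
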